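(* Let $f$, $\tau_0,\dots,\tau_m$, $A_0,\dots,A_m$, $\mathrm{s}$, $\mathrm{c}$ be as in the context, and fix an arbitrary $\sigma\in\mathbb{R}$. Consider the system of $3n+2$ scalar equations in the unknowns $(\tilde x,\alpha,\omega,a,b)\in\mathbb{R}^n\times\mathbb{R}^{n_\alpha}\times\mathbb{R}\times\mathbb{R}^n\times\mathbb{R}^n$, where $A_i=A_i(\tilde x,\alpha)$ and $\tau_i=\tau_i(\tilde x,\alpha)$: $$ \begin{aligned} f(\tilde x,\tilde x,\dots,\tilde x,\alpha)&=0,\\ \sigma a-\omega b-\sum_{i=0}^m A_i\big(\mathrm{c}(\sigma,\omega,\tau_i)a+\mathrm{s}(\sigma,\omega,\tau_i)b\big)&=0,\\ \omega a+\sigma b-\sum_{i=0}^m A_i\big(\mathrm{c}(\sigma,\omega,\tau_i)b-\mathrm{s}(\sigma,\omega,\tau_i)a\big)&=0,\\ a^\prime a+b^\prime b-1&=0,\\ a^\prime b&=0. \end{aligned}\tag{A} $$ Suppose $(\tilde x^{(c)},\alpha^{(c)},\omega,a,b)$ is a regular solution of (A). Let $r\in\mathbb{R}^{n_\alpha}$ be such that there is a $\kappa\in\mathbb{R}^{3n+2}$ with $$ \begin{bmatrix} \nabla_{\tilde x^{(c)}}f^\prime&B_{12}&B_{13}&0&0\\ 0&B_{22}&B_{23}&2a&b\\ 0&B_{32}&B_{33}&2b&a\\ 0&B_{42}&B_{43}&0&0 \end{bmatrix}\kappa=0,\qquad \begin{bmatrix}\nabla_{\alpha^{(c)}}f^\prime&B_{52}&B_{53}&0&0\end{bmatrix}\kappa-r=0,\qquad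 r^\prime r-1=0, $$ where, writing $\mathrm{c}_i=\mathrm{c}(\sigma,\omega,\tau_i)$ and $\mathrm{s}_i=\mathrm{s}(\sigma,\omega,\tau_i)$, and with everything evaluated at the given solution, $$ \begin{aligned} B_{12}=&\sum_{i=0}^m \sigma(\nabla_{\tilde x^{(c)}}\tau_i)\big(\mathrm{c}_i a^\prime+\mathrm{s}_i b^\prime\big)A_i^\prime-\sum_{i=0}^m\omega(\nabla_{\tilde x^{(c)}}\tau_i)\big(\mathrm{c}_i b^\prime-\mathrm{s}_i a^\prime\big)A_i^\prime\\ &-\sum_{i=0}^m\Big[\mathrm{c}_i(\nabla_{\tilde x^{(c)}}a^\prime A_i^\prime)+\mathrm{s}_i(\nabla_{\tilde x^{(c)}}b^\prime A_i^\prime)\Big],\\ B_{13}=&\sum_{i=0}^m \sigma(\nabla_{\tilde x^{(c)}}\tau_i)\big(\mathrm{c}_i b^\prime-\mathrm{s}_i a^\prime\big)A_i^\prime+\sum_{i=0}^m\omega(\nabla_{\tilde x^{(c)}}\tau_i)\big(\mathrm{s}_i b^\prime+\mathrm{c}_i a^\prime\big)A_i^\prime\\ &-\sum_{i=0}^m\Big[\mathrm{c}_i(\nabla_{\tilde x^{(c)}}b^\prime A_i^\prime)-\mathrm{s}_i(\nabla_{\tilde x^{(c)}}a^\prime A_i^\prime)\Big],\\ B_{22}=&\ \sigma I-\sum_{i=0}^m\mathrm{c}_iA_i^\prime,\qquad B_{23}=\omega I+\sum_{i=0}^m\mathrm{s}_iA_i^\prime,\\ B_{32}=&-\omega I-\sum_{i=0}^m\mathrm{s}_iA_i^\prime,\qquad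 B_{33}=\sigma I-\sum_{i=0}^m\mathrm{c}_iA_i^\prime,\\ B_{42}=&-b^\prime+\sum_{i=0}^m\tau_i\big(\mathrm{s}_ia^\prime-\mathrm{c}_ib^\prime\big)A_i^\prime,\qquad B_{43}=a^\prime+\sum_{i=0}^m\tau_i\big(\mathrm{s}_ib^\prime+\mathrm{c}_ia^\prime\big)A_i^\prime,\\ B_{52}=&\sum_{i=0}^m\sigma(\nabla_{\alpha^{(c)}}\tau_i)\big(\mathrm{c}_ia^\prime+\mathrm{s}_ib^\prime\big)A_i^\prime+\sum_{i=0}^m\omega(\nabla_{\alpha^{(c)}}\tau_i)\big(\mathrm{s}_ia^\prime-\mathrm{c}_ib^\prime\big)A_i^\prime\\ &-\sum_{i=0}^m\Big[\mathrm{c}_i(\nabla_{\alpha^{(c)}}a^\prime A_i^\prime)+\mathrm{s}_i(\nabla_{\alpha^{(c)}}b^\prime A_i^\prime)\Big],\\ B_{53}=&\sum_{i=0}^m\sigma(\nabla_{\alpha^{(c)}}\tau_i)\big(\mathrm{c}_ib^\prime-\mathrm{s}_ia^\prime\big)A_i^\prime+\sum_{i=0}^m\omega(\nabla_{\alpha^{(c)}}\tau_i)\big(\mathrm{s}_ib^\prime+\mathrm{c}_ia^\prime\big)A_i^\prime\\ &-\sum_{i=0}^m\Big[\mathrm{c}_i(\nabla_{\alpha^{(c)}}b^\prime A_i^\prime)-\mathrm{s}_i(\nabla_{\alpha^{(c)}}a^\prime A_i^\prime)\Big]. \end{aligned} $$ Then $r$ is normal (in the parameter space $\mathbb{R}^{n_\alpha}$)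 to the manifold of modified Hopf points at the solution $(\tilde x^{(c)},\alpha^{(c)},\omega,a,b)$.
   Context: **System.** Consider the delay differential system $\dot x(t)=f(x(t),x(t-\tau_1),\dots,x(t-\tau_m),\alpha)$ with state $x\in\mathbb{R}^n$, parameters $\alpha\in\mathbb{R}^{n_\alpha}$, and $f$ a smooth map from $\mathbb{R}^{n(m+1)}\times\mathbb{R}^{n_\alpha}$ (or an open subset thereof) into $\mathbb{R}^n$. The delays may depend on the current state and the parameters, $\tau_i=\tau_i(x(t),\alpha)$, $i=1,\dots,m$, with $\tau_i$ smooth real-valued functions. Put $\tau_0=0$, so that $x(t)=x(t-\tau_0)$. **Notation.** A prime denotes transposition and $I$ the $n\times n$ identity matrix. $\mathrm{s}(\sigma,\omega,\tau)=\exp(-\sigma\tau)\sin(\omega\tau)$ and $\mathrm{c}(\sigma,\omega,\tau)=\exp(-\sigma\tau)\cos(\omega\tau)$. A steady state for $\alpha$ is a point $\tilde x\in\mathbb{R}^n$ with $f(\tilde x,\dots,\tilde x,\alpha)=0$. For $i=0,\dots,m$, $A_i$ is the $n\times n$ Jacobian of $f$ with respect to its argument $x(t-\tau_i)$ (the $(i+1)$-st block argument), i.e. $(A_i)_{\rho,\nu}=\partial f_\rho/\partial x_\nu(t-\tau_i)$, evaluated at $(\tilde x,\dots,\tilde x,\alpha)$; thus $A_i=A_i(\tilde x,\alpha)$, and similarly $\tau_i=\tau_i(\tilde x,\alpha)$. **Gradients.** For a scalar function $g$, $\nabla_y g$ is the column vector of partial derivatives with respect to $y$. For a row-vector-valued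 function $g^\prime$, $\nabla_y g^\prime$ is the matrix with $(\mu,\nu)$ entry $\partial g_\nu/\partial y_\mu$ (the transposed Jacobian). $\nabla_{\tilde x^{(c)}}f^\prime$ and $\nabla_{\alpha^{(c)}}f^\prime$ are the transposed Jacobians of $(\tilde x,\alpha)\mapsto f(\tilde x,\dots,\tilde x,\alpha)$ with respect to $\tilde x$ (which enters through all $m+1$ state arguments) and $\alpha$, at $(\tilde x^{(c)},\alpha^{(c)})$. The matrix $\nabla_{\tilde x^{(c)}}a^\prime A_i^\prime$ is the derivative of the row vector $a^\prime A_i^\prime$ with respect to $\tilde x$ with $a$ held fixed: $$(\nabla_{\tilde x^{(c)}}a^\prime A_i^\prime)_{\mu,\nu}=\sum_{\rho=1}^n a_\rho\,\frac{\partial^2 f_\nu}{\partial\tilde x_\mu^{(c)}\,\partial\tilde x^{(c)}_\rho(t-\tau_i)},$$ where $\partial/\partial\tilde x_\mu^{(c)}$ differentiates with respect to the common steady-state value $\tilde x$ in all state arguments and $\partial/\partial \tilde x^{(c)}_\rho(t-\tau_i)$ differentiates with respect to the $\rho$-th component of the argument $x(t-\tau_i)$ only. The matrices $\nabla_{\tilde x^{(c)}}b^\prime A_i^\prime$, $\nabla_{\alpha^{(c)}}a^\prime A_i^\prime$ and $\nabla_{\alpha^{(c)}}b^\prime A_i^\prime$ are defined accordingly (with $b$ in place of $a$, and/or $\alpha^{(c)}_\mu$ in place of $\tilde x^{(c)}_\mu$). **Regular solution.** A solution of a set of nonlinear equations is regular if the Jacobian of the equations evaluated at this solution has full rank. Here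 this is the $(3n+2)\times(3n+n_\alpha+1)$ Jacobian of system (A) with respect to all the variables $(\tilde x,a,b,\omega,\alpha)$, with $\sigma$ fixed. **Modified Hopf points and manifold.** A number $\lambda\in\mathbb{C}$ is an eigenvalue at a steady state $\tilde x$ if $\det\big(\lambda I-A_0-\sum_{i=1}^mA_i\exp(-\lambda\tau_i)\big)=0$. A modified Hopf point is a steady state that has a leading complex conjugate pair of eigenvalues $\sigma\pm\mathrm{i}\omega$ with nonzero real part; a manifold of such points is a modified Hopf manifold. For fixed $\sigma$, the manifold of modified Hopf points near a regular solution of (A) is the $(n_\alpha-1)$-dimensional manifold $M\subset\mathbb{R}^n\times\mathbb{R}^{n_\alpha}\times\mathbb{R}\times\mathbb{R}^n\times\mathbb{R}^n$ defined locally by the equations (A). A vector $r\in\mathbb{R}^{n_\alpha}$ is normal (in parameter space) to this manifold at a point if the vector with $\alpha$-component $r$ and zero $\tilde x$-, $\omega$-, $a$-, $b$-components belongs to the normal space of $M$ at that point; equivalently, $r$ is orthogonal to the $\alpha$-component of every tangent vector of $M$ at that point. *)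

theory Defs
  imports "HOL-Analysis.Analysis"
begin

text \<open>Meant for open \<open>S\<close> only: the derivatives are taken without restriction to \<open>S\<close>.\<close>

primrec Ck_on :: "nat \<Rightarrow> 'a::euclidean_space set \<Rightarrow> ('a \<Rightarrow> 'b::euclidean_space) \<Rightarrow> bool" where
  "Ck_on 0 S f \<longleftrightarrow> continuous_on S f"
| "Ck_on (Suc k) S f \<longleftrightarrow> (\<forall>x\<in>S. f differentiable (at x)) \<and>
     (\<forall>v. Ck_on k S (\<lambda>x. frechet_derivative f (at x) v))"

definition smooth_on :: "'a::euclidean_space set \<Rightarrow> ('a \<Rightarrow> 'b::euclidean_space) \<Rightarrow> bool" where
  "smooth_on S f \<longleftrightarrow> (\<forall>k. Ck_on k S f)"

definition grad :: "(real^'k \<Rightarrow> real) \<Rightarrow> real^'k \<Rightarrow> real^'k" where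
  "grad g y = (\<chi> \<mu>. frechet_derivative g (at y) (axis \<mu> 1))"

text \<open>Entry (\<open>\<mu>\<close>, \<open>\<nu>\<close>) is the partial derivative of the \<open>\<nu>\<close>-th component of \<open>g\<close>
  with respect to the \<open>\<mu>\<close>-th variable.\<close>

definition grad_row :: "(real^'k \<Rightarrow> real^'n) \<Rightarrow> real^'k \<Rightarrow> real^'n^'k" where
  "grad_row g y = transpose (jacobian g (at y))"

definition outer :: "real^'k \<Rightarrow> real^'n \<Rightarrow> real^'n^'k" where
  "outer u v = (\<chi> \<mu> \<nu>. u $ \<mu> * v $ \<nu>)"

definition dsin :: "real \<Rightarrow> real \<Rightarrow> real \<Rightarrow> real" where
  "dsin \<sigma> \<omega> t = exp (- \<sigma> * t) * sin (\<omega> * t)"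

definition dcos :: "real \<Rightarrow> real \<Rightarrow> real \<Rightarrow> real" where
  "dcos \<sigma> \<omega> t = exp (- \<sigma> * t) * cos (\<omega> * t)"

text \<open>
  The \<open>m + 1\<close> state arguments of \<open>f\<close> are indexed by a finite type \<open>'d\<close>; the family of
  delays \<open>\<tau>\<close> has the same index type and contains the zero delay at one distinguished index.
  The diagonal argument \<open>(x, \<dots>, x)\<close> is \<open>vec x\<close>, and \<open>Amat f i x \<alpha>\<close> is the Jacobian
  with respect to the \<open>i\<close>-th state argument at the diagonal.
\<close>

definition Amat :: "((real^'n^'d::finite) \<times> (real^'p) \<Rightarrow> real^'n) \<Rightarrow> 'd \<Rightarrow> real^'n \<Rightarrow> real^'p \<Rightarrow> real^'n^'n" where
  "Amat f i x \<alpha> = jacobian (\<lambda>u. f (\<chi> j. if j = i then u else x, \<alpha>)) (at x)"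

type_synonym ('n, 'p) hopf_var = "(real^'n) \<times> (real^'p) \<times> real \<times> (real^'n) \<times> (real^'n)"
type_synonym 'n hopf_eqs = "(real^'n) \<times> (real^'n) \<times> (real^'n) \<times> real \<times> real"

definition hopf_system ::
  "real \<Rightarrow> ((real^'n^'d::finite) \<times> (real^'p) \<Rightarrow> real^'n) \<Rightarrow> ('d \<Rightarrow> (real^'n) \<times> (real^'p) \<Rightarrow> real) \<Rightarrow>
   ('n, 'p) hopf_var \<Rightarrow> 'n hopf_eqs" where
  "hopf_system \<sigma> f \<tau> = (\<lambda>(x, \<alpha>, \<omega>, a, b).
     let A = (\<lambda>i. Amat f i x \<alpha>);
         c = (\<lambda>i. dcos \<sigma> \<omega> (\<tau> i (x, \<alpha>)));
         s = (\<lambda>i. dsin \<sigma> \<omega> (\<tau> i (x, \<alpha>)))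
     in (f (vec x, \<alpha>),
         \<sigma> *\<^sub>R a - \<omega> *\<^sub>R b - (\<Sum>i\<in>UNIV. A i *v (c i *\<^sub>R a + s i *\<^sub>R b)),
         \<omega> *\<^sub>R a + \<sigma> *\<^sub>R b - (\<Sum>i\<in>UNIV. A i *v (c i *\<^sub>R b - s i *\<^sub>R a)),
         a \<bullet> a + b \<bullet> b - 1,
         a \<bullet> b))"

text \<open>\<open>D\<close> is the domain of \<open>f\<close> and \<open>E\<close> that of the delay functions.\<close>

definition hopf_solutions ::
  "((real^'n^'d::finite) \<times> (real^'p)) set \<Rightarrow> ((real^'n) \<times> (real^'p)) set \<Rightarrow> real \<Rightarrow>
   ((real^'n^'d) \<times> (real^'p) \<Rightarrow> real^'n) \<Rightarrow> ('d \<Rightarrow> (real^'n) \<times> (real^'p) \<Rightarrow> real) \<Rightarrow>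
   ('n, 'p) hopf_var set" where
  "hopf_solutions D E \<sigma> f \<tau> =
     {(x, \<alpha>, \<omega>, a, b). (vec x, \<alpha>) \<in> D \<and> (x, \<alpha>) \<in> E \<and> hopf_system \<sigma> f \<tau> (x, \<alpha>, \<omega>, a, b) = 0}"

text \<open>The rank of the Jacobian is the dimension of the range of the derivative;
  meant for maps differentiable at the point.\<close>

definition jacobian_full_rank :: "('a::euclidean_space \<Rightarrow> 'b::euclidean_space) \<Rightarrow> 'a \<Rightarrow> bool" where
  "jacobian_full_rank F p \<longleftrightarrow>
     dim (range (frechet_derivative F (at p))) = min DIM('a) DIM('b)"

text \<open>Velocities of curves in \<open>M\<close> through \<open>p\<close>. If \<open>M\<close> is a submanifold near \<open>p\<close>, then
  this is its tangent space at \<open>p\<close>.\<close>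

definition tangent_vectors :: "'a::euclidean_space set \<Rightarrow> 'a \<Rightarrow> 'a set" where
  "tangent_vectors M p = {v. \<exists>\<gamma> \<epsilon>. \<epsilon> > 0 \<and> (\<forall>t. \<bar>t\<bar> < \<epsilon> \<longrightarrow> \<gamma> t \<in> M) \<and> \<gamma> 0 = p \<and>
     (\<gamma> has_vector_derivative v) (at (0::real))}"

definition normal_space :: "'a::euclidean_space set \<Rightarrow> 'a \<Rightarrow> 'a set" where
  "normal_space M p = (tangent_vectors M p)\<^sup>\<bottom>"

definition normal_in_parameter_space ::
  "real^'p \<Rightarrow> ('n::finite, 'p) hopf_var set \<Rightarrow> ('n, 'p) hopf_var \<Rightarrow> bool" where
  "normal_in_parameter_space r M p \<longleftrightarrow> (0, r, 0, 0, 0) \<in> normal_space M p"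

text \<open>A row vector is represented by an element of \<open>real^'n\<close>. \<open>rowP\<close> and \<open>rowQ\<close> are
  \<open>(c a' + s b') A'\<close> and \<open>(c b' - s a') A'\<close> for the \<open>i\<close>-th delay.\<close>

definition rowP where
  "rowP \<sigma> f \<tau> x \<alpha> \<omega> a b i =
     (dcos \<sigma> \<omega> (\<tau> i (x, \<alpha>)) *\<^sub>R a + dsin \<sigma> \<omega> (\<tau> i (x, \<alpha>)) *\<^sub>R b) v* transpose (Amat f i x \<alpha>)"

definition rowQ where
  "rowQ \<sigma> f \<tau> x \<alpha> \<omega> a b i =
     (dcos \<sigma> \<omega> (\<tau> i (x, \<alpha>)) *\<^sub>R b - dsin \<sigma> \<omega> (\<tau> i (x, \<alpha>)) *\<^sub>R a) v* transpose (Amat f i x \<alpha>)"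

definition B11 where
  "B11 f x \<alpha> = grad_row (\<lambda>y. f (vec y, \<alpha>)) x"

definition B12 where
  "B12 \<sigma> f \<tau> x \<alpha> \<omega> a b =
     (\<Sum>i\<in>UNIV. \<sigma> *\<^sub>R outer (grad (\<lambda>y. \<tau> i (y, \<alpha>)) x) (rowP \<sigma> f \<tau> x \<alpha> \<omega> a b i))
   - (\<Sum>i\<in>UNIV. \<omega> *\<^sub>R outer (grad (\<lambda>y. \<tau> i (y, \<alpha>)) x) (rowQ \<sigma> f \<tau> x \<alpha> \<omega> a b i))
   - (\<Sum>i\<in>UNIV. dcos \<sigma> \<omega> (\<tau> i (x, \<alpha>)) *\<^sub>R grad_row (\<lambda>y. a v* transpose (Amat f i y \<alpha>)) x
             + dsin \<sigma> \<omega> (\<tau> i (x, \<alpha>)) *\<^sub>R grad_row (\<lambda>y. b v* transpose (Amat f i y \<alpha>)) x)"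

definition B13 where
  "B13 \<sigma> f \<tau> x \<alpha> \<omega> a b =
     (\<Sum>i\<in>UNIV. \<sigma> *\<^sub>R outer (grad (\<lambda>y. \<tau> i (y, \<alpha>)) x) (rowQ \<sigma> f \<tau> x \<alpha> \<omega> a b i))
   + (\<Sum>i\<in>UNIV. \<omega> *\<^sub>R outer (grad (\<lambda>y. \<tau> i (y, \<alpha>)) x) (rowP \<sigma> f \<tau> x \<alpha> \<omega> a b i))
   - (\<Sum>i\<in>UNIV. dcos \<sigma> \<omega> (\<tau> i (x, \<alpha>)) *\<^sub>R grad_row (\<lambda>y. b v* transpose (Amat f i y \<alpha>)) x
             - dsin \<sigma> \<omega> (\<tau> i (x, \<alpha>)) *\<^sub>R grad_row (\<lambda>y. a v* transpose (Amat f i y \<alpha>)) x)"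

definition B22 where
  "B22 \<sigma> f \<tau> x \<alpha> \<omega> =
     \<sigma> *\<^sub>R mat 1 - (\<Sum>i\<in>UNIV. dcos \<sigma> \<omega> (\<tau> i (x, \<alpha>)) *\<^sub>R transpose (Amat f i x \<alpha>))"

definition B23 where
  "B23 \<sigma> f \<tau> x \<alpha> \<omega> =
     \<omega> *\<^sub>R mat 1 + (\<Sum>i\<in>UNIV. dsin \<sigma> \<omega> (\<tau> i (x, \<alpha>)) *\<^sub>R transpose (Amat f i x \<alpha>))"

definition B32 where
  "B32 \<sigma> f \<tau> x \<alpha> \<omega> =
     - \<omega> *\<^sub>R mat 1 - (\<Sum>i\<in>UNIV. dsin \<sigma> \<omega> (\<tau> i (x, \<alpha>)) *\<^sub>R transpose (Amat f i x \<alpha>))"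

definition B33 where
  "B33 \<sigma> f \<tau> x \<alpha> \<omega> =
     \<sigma> *\<^sub>R mat 1 - (\<Sum>i\<in>UNIV. dcos \<sigma> \<omega> (\<tau> i (x, \<alpha>)) *\<^sub>R transpose (Amat f i x \<alpha>))"

definition B42 where
  "B42 \<sigma> f \<tau> x \<alpha> \<omega> a b =
     - b + (\<Sum>i\<in>UNIV. \<tau> i (x, \<alpha>) *\<^sub>R
       ((dsin \<sigma> \<omega> (\<tau> i (x, \<alpha>)) *\<^sub>R a - dcos \<sigma> \<omega> (\<tau> i (x, \<alpha>)) *\<^sub>R b) v* transpose (Amat f i x \<alpha>)))"

definition B43 where
  "B43 \<sigma> f \<tau> x \<alpha> \<omega> a b =
     a + (\<Sum>i\<in>UNIV. \<tau> i (x, \<alpha>) *\<^sub>R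
       ((dsin \<sigma> \<omega> (\<tau> i (x, \<alpha>)) *\<^sub>R b + dcos \<sigma> \<omega> (\<tau> i (x, \<alpha>)) *\<^sub>R a) v* transpose (Amat f i x \<alpha>)))"

definition B51 where
  "B51 f x \<alpha> = grad_row (\<lambda>\<beta>. f (vec x, \<beta>)) \<alpha>"

definition B52 where
  "B52 \<sigma> f \<tau> x \<alpha> \<omega> a b =
     (\<Sum>i\<in>UNIV. \<sigma> *\<^sub>R outer (grad (\<lambda>\<beta>. \<tau> i (x, \<beta>)) \<alpha>) (rowP \<sigma> f \<tau> x \<alpha> \<omega> a b i))
   + (\<Sum>i\<in>UNIV. \<omega> *\<^sub>R outer (grad (\<lambda>\<beta>. \<tau> i (x, \<beta>)) \<alpha>)
       ((dsin \<sigma> \<omega> (\<tau> i (x, \<alpha>)) *\<^sub>R a - dcos \<sigma> \<omega> (\<tau> i (x, \<alpha>)) *\<^sub>R b) v* transpose (Amat f i x \<alpha>)))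
   - (\<Sum>i\<in>UNIV. dcos \<sigma> \<omega> (\<tau> i (x, \<alpha>)) *\<^sub>R grad_row (\<lambda>\<beta>. a v* transpose (Amat f i x \<beta>)) \<alpha>
             + dsin \<sigma> \<omega> (\<tau> i (x, \<alpha>)) *\<^sub>R grad_row (\<lambda>\<beta>. b v* transpose (Amat f i x \<beta>)) \<alpha>)"

definition B53 where
  "B53 \<sigma> f \<tau> x \<alpha> \<omega> a b =
     (\<Sum>i\<in>UNIV. \<sigma> *\<^sub>R outer (grad (\<lambda>\<beta>. \<tau> i (x, \<beta>)) \<alpha>) (rowQ \<sigma> f \<tau> x \<alpha> \<omega> a b i))
   + (\<Sum>i\<in>UNIV. \<omega> *\<^sub>R outer (grad (\<lambda>\<beta>. \<tau> i (x, \<beta>)) \<alpha>) (rowP \<sigma> f \<tau> x \<alpha> \<omega> a b i))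
   - (\<Sum>i\<in>UNIV. dcos \<sigma> \<omega> (\<tau> i (x, \<alpha>)) *\<^sub>R grad_row (\<lambda>\<beta>. b v* transpose (Amat f i x \<beta>)) \<alpha>
             - dsin \<sigma> \<omega> (\<tau> i (x, \<alpha>)) *\<^sub>R grad_row (\<lambda>\<beta>. a v* transpose (Amat f i x \<beta>)) \<alpha>)"

end

theory Submission
  imports Defs
begin

text \<open>
  All points of the manifold solve system (A), so along any differentiable curve in it the
  left-hand side \<open>F\<close> of (A) is constantly zero, and the chain rule gives \<open>F' V = 0\<close> for every
  tangent vector \<open>V\<close>. Consequently every vector of the form \<open>F'\<^sup>T \<kappa>\<close> is orthogonal to all tangent
  vectors (\<open>normal_space_of_zero_set\<close>).

  The blocks \<open>B\<close> form the transposed Jacobian \<open>F'\<^sup>T\<close>: the first four block rows are the gradients with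
  respect to \<open>x\<close>, \<open>a\<close>, \<open>b\<close> and \<open>\<omega>\<close>, and the fifth is the gradient with respect to \<open>\<alpha>\<close>
  (\<open>hopf_system_has_derivative\<close>). The hypotheses on \<open>\<kappa>\<close> and \<open>r\<close> therefore say exactly that \<open>F'\<^sup>T \<kappa>\<close>
  has \<open>\<alpha>\<close>-component \<open>r\<close> and all other components zero, and this vector is normal.

  The bulk of the work is the derivative of \<open>F\<close>. It requires the matrices \<open>A\<^sub>i\<close> to depend
  differentiably on \<open>(x, \<alpha>)\<close>, which follows from \<open>f\<close> being twice differentiable because
  \<open>A\<^sub>i h\<close> is a directional derivative of \<open>f\<close> on the diagonal (\<open>Amat_mult_vector\<close>,
  \<open>differentiable_Amat\<close>).
\<close>

section \<open>Gradients and partial derivatives\<close>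

lemma bounded_bilinear_matrix_vector_mult:
  "bounded_bilinear ((*v) :: real^'n^'m \<Rightarrow> real^'n \<Rightarrow> real^'m)"
  unfolding bilinear_conv_bounded_bilinear[symmetric] bilinear_def
  by (auto intro!: linearI simp: matrix_vector_mult_add_rdistrib matrix_vector_right_distrib
      vec_eq_iff matrix_vector_mult_def sum_distrib_left sum.distrib algebra_simps)

lemma bounded_bilinear_vector_matrix_mult:
  "bounded_bilinear ((v*) :: real^'m \<Rightarrow> real^'n^'m \<Rightarrow> real^'n)"
  unfolding bilinear_conv_bounded_bilinear[symmetric] bilinear_def
  by (auto intro!: linearI simp: vec_eq_iff vector_matrix_mult_def sum_distrib_left sum.distrib
      algebra_simps)

lemma vector_matrix_mult_outer: "h v* outer u v = (u \<bullet> h) *\<^sub>R v"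
  by (simp add: vec_eq_iff vector_matrix_mult_def outer_def inner_vec_def
      sum_distrib_left sum_distrib_right mult_ac)

lemma has_derivative_grad:
  assumes "g differentiable at y"
  shows "(g has_derivative (\<lambda>h. grad g y \<bullet> h)) (at y)"
proof -
  let ?g' = "frechet_derivative g (at y)"
  have g': "(g has_derivative ?g') (at y)"
    using assms frechet_derivative_works by blast
  interpret bounded_linear ?g'
    using g' by (rule has_derivative_bounded_linear)
  have "?g' h = grad g y \<bullet> h" for h
  proof -
    have "?g' h = ?g' (\<Sum>\<mu>\<in>UNIV. h $ \<mu> *\<^sub>R axis \<mu> 1)"
      by (simp add: basis_expansion flip: scalar_mult_eq_scaleR)
    then show ?thesis
      by (simp add: sum scaleR grad_def inner_vec_def mult.commute)
  qed
  then have "?g' = (\<lambda>h. grad g y \<bullet> h)"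
    by blast
  with g' show ?thesis
    by simp
qed

lemma has_derivative_grad_row:
  assumes "g differentiable at y"
  shows "(g has_derivative (\<lambda>h. h v* grad_row g y)) (at y)"
  using assms jacobian_works[of g "at y"]
  by (simp add: grad_row_def)

text \<open>The blocks \<open>B\<close> contain gradients in \<open>x\<close> and in \<open>\<alpha>\<close> separately, while the chain rule needs the
  derivative in the pair. Total differentiability and linearity make the latter the sum of the
  partial derivatives.\<close>

lemma frechet_derivative_split:
  assumes "g differentiable at (x, y)"
    and "((\<lambda>u. g (u, y)) has_derivative g1) (at x)"
    and "((\<lambda>v. g (x, v)) has_derivative g2) (at y)"
  shows "frechet_derivative g (at (x, y)) (h, k) = g1 h + g2 k"
proof -
  let ?g' = "frechet_derivative g (at (x, y))"
  have g': "(g has_derivative ?g') (at (x, y))"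
    using assms(1) frechet_derivative_works by blast
  interpret bounded_linear ?g'
    using g' by (rule has_derivative_bounded_linear)
  have "((\<lambda>u. g (u, y)) has_derivative (\<lambda>h. ?g' (h, 0))) (at x)"
    by (rule has_derivative_compose[where g = g and f = "\<lambda>u. (u, y)"])
       (auto intro!: derivative_eq_intros g')
  then have 1: "g1 = (\<lambda>h. ?g' (h, 0))"
    using assms(2) has_derivative_unique by blast
  have "((\<lambda>v. g (x, v)) has_derivative (\<lambda>k. ?g' (0, k))) (at y)"
    by (rule has_derivative_compose[where g = g and f = "\<lambda>v. (x, v)"])
       (auto intro!: derivative_eq_intros g')
  then have 2: "g2 = (\<lambda>k. ?g' (0, k))"
    using assms(3) has_derivative_unique by blast
  show ?thesis
    by (simp add: 1 2 flip: add)
qed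

lemma differentiable_slices:
  assumes "g differentiable at (x, y)"
  shows "(\<lambda>u. g (u, y)) differentiable at x" "(\<lambda>v. g (x, v)) differentiable at y"
proof -
  obtain g' where "(g has_derivative g') (at (x, y))"
    using assms by (auto simp: differentiable_def)
  then show "(\<lambda>u. g (u, y)) differentiable at x" "(\<lambda>v. g (x, v)) differentiable at y"
    by (auto simp: differentiable_def intro!: exI
        has_derivative_compose[where g = g and f = "\<lambda>u. (u, y)"]
        has_derivative_compose[where g = g and f = "\<lambda>v. (x, v)"] derivative_eq_intros)
qed

lemma frechet_derivative_gradients:
  fixes g :: "(real^'k) \<times> (real^'p) \<Rightarrow> real"
  assumes "g differentiable at (x, \<alpha>)"
  shows "frechet_derivative g (at (x, \<alpha>)) (h, k) =
    grad (\<lambda>y. g (y, \<alpha>)) x \<bullet> h + grad (\<lambda>\<beta>. g (x, \<beta>)) \<alpha> \<bullet> k"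
  by (rule frechet_derivative_split[OF assms]) (intro has_derivative_grad differentiable_slices assms)+

lemma frechet_derivative_gradient_rows:
  fixes g :: "(real^'k) \<times> (real^'p) \<Rightarrow> real^'n"
  assumes "g differentiable at (x, \<alpha>)"
  shows "frechet_derivative g (at (x, \<alpha>)) (h, k) =
    h v* grad_row (\<lambda>y. g (y, \<alpha>)) x + k v* grad_row (\<lambda>\<beta>. g (x, \<beta>)) \<alpha>"
  by (rule frechet_derivative_split[OF assms]) (intro has_derivative_grad_row differentiable_slices assms)+

text \<open>The matrices \<open>\<nabla>(a' A')\<close> are derivatives with \<open>a\<close> held fixed, yet \<open>a\<close> is itself an
  unknown. Differentiating the matrix and applying the result to \<open>a\<close> gives the same as
  differentiating \<open>A a\<close> for constant \<open>a\<close>, so the product rule produces these blocks.\<close>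

lemma frechet_derivative_matrix_apply:
  fixes A :: "(real^'k) \<times> (real^'p) \<Rightarrow> real^'m^'n"
  assumes "A differentiable at (x, \<alpha>)"
  shows "frechet_derivative A (at (x, \<alpha>)) (h, k) *v a =
    h v* grad_row (\<lambda>y. A (y, \<alpha>) *v a) x + k v* grad_row (\<lambda>\<beta>. A (x, \<beta>) *v a) \<alpha>"
proof -
  have "((\<lambda>z. A z *v a) has_derivative (\<lambda>z. frechet_derivative A (at (x, \<alpha>)) z *v a)) (at (x, \<alpha>))"
    using bounded_linear.has_derivative[OF bounded_bilinear.bounded_linear_left
        [OF bounded_bilinear_matrix_vector_mult]] assms frechet_derivative_works by blast
  then show ?thesis
    using frechet_derivative_gradient_rows[of "\<lambda>z. A z *v a" x \<alpha> h k] frechet_derivative_at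
    by (metis differentiableI)
qed

section \<open>The derivative of the modified Hopf system\<close>

lemma has_derivative_dcos:
  assumes "(w has_derivative w') (at p)" "(t has_derivative t') (at p)"
  shows "((\<lambda>z. dcos \<sigma> (w z) (t z)) has_derivative
    (\<lambda>h. - (\<sigma> * dcos \<sigma> (w p) (t p) + w p * dsin \<sigma> (w p) (t p)) * t' h
         - t p * dsin \<sigma> (w p) (t p) * w' h)) (at p)"
  unfolding dcos_def dsin_def
  by (auto intro!: derivative_eq_intros assms simp: fun_eq_iff algebra_simps)

lemma has_derivative_dsin:
  assumes "(w has_derivative w') (at p)" "(t has_derivative t') (at p)"
  shows "((\<lambda>z. dsin \<sigma> (w z) (t z)) has_derivative
    (\<lambda>h. (w p * dcos \<sigma> (w p) (t p) - \<sigma> * dsin \<sigma> (w p) (t p)) * t' h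
         + t p * dcos \<sigma> (w p) (t p) * w' h)) (at p)"
  unfolding dcos_def dsin_def
  by (auto intro!: derivative_eq_intros assms simp: fun_eq_iff algebra_simps)

text \<open>Moving only the \<open>i\<close>-th state argument away from the diagonal is an affine motion in the
  direction \<open>axis i h\<close>, so the chain rule applies.\<close>

lemma Amat_mult_vector:
  assumes "f differentiable at (vec x, \<alpha>)"
  shows "Amat f i x \<alpha> *v h = frechet_derivative f (at (vec x, \<alpha>)) (axis i h, 0)"
proof -
  let ?f' = "frechet_derivative f (at (vec x, \<alpha>))"
  have f': "(f has_derivative ?f') (at (vec x, \<alpha>))"
    using assms frechet_derivative_works by blast
  have ax: "bounded_linear (axis i :: real^'a \<Rightarrow> real^'a^'b)"
    unfolding linear_conv_bounded_linear[symmetric]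
    by (auto intro!: linearI simp: axis_def vec_eq_iff)
  have eq: "(\<lambda>u. (\<chi> j. if j = i then u else x, \<alpha>)) = (\<lambda>u. (vec x + axis i (u - x), \<alpha>))"
    by (auto simp: fun_eq_iff vec_eq_iff axis_def)
  have "((\<lambda>u. f (vec x + axis i (u - x), \<alpha>)) has_derivative (\<lambda>h. ?f' (axis i h, 0))) (at x)"
    by (rule has_derivative_compose[where g = f and f = "\<lambda>u. (vec x + axis i (u - x), \<alpha>)"])
       (use f' in \<open>auto intro!: derivative_eq_intros bounded_linear.has_derivative[OF ax]
         simp: linear_0[OF bounded_linear.linear[OF ax]]\<close>)
  then have "((\<lambda>u. f (\<chi> j. if j = i then u else x, \<alpha>)) has_derivative (\<lambda>h. ?f' (axis i h, 0))) (at x)"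
    using eq by (simp add: fun_eq_iff)
  moreover from this have "((\<lambda>u. f (\<chi> j. if j = i then u else x, \<alpha>)) has_derivative
      (\<lambda>h. Amat f i x \<alpha> *v h)) (at x)"
    unfolding Amat_def using jacobian_works differentiableI by blast
  ultimately show ?thesis
    by (metis has_derivative_unique)
qed

lemma bounded_linear_diagonal:
  "bounded_linear (\<lambda>z. (vec (fst z), snd z) :: (real^'n^'d) \<times> (real^'p))"
  unfolding linear_conv_bounded_linear[symmetric] by (auto intro!: linearI simp: vec_eq_iff)

text \<open>Near a point whose diagonal lies in \<open>D\<close>, each column of \<open>A\<^sub>i\<close> is a first-order partial derivative
  of \<open>f\<close> composed with the diagonal embedding, and a second derivative of \<open>f\<close> makes it
  differentiable. Openness of \<open>D\<close> provides the neighbourhood on which this description is valid.\<close>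

lemma differentiable_Amat:
  fixes f :: "(real^'n^'d) \<times> (real^'p) \<Rightarrow> real^'n"
  assumes "open D" "smooth_on D f" "(vec x, \<alpha>) \<in> D"
  shows "(\<lambda>z. Amat f i (fst z) (snd z)) differentiable at (x, \<alpha>)"
proof -
  define \<iota> :: "(real^'n) \<times> (real^'p) \<Rightarrow> (real^'n^'d) \<times> (real^'p)" where "\<iota> = (\<lambda>z. (vec (fst z), snd z))"
  have lin: "bounded_linear \<iota>"
    unfolding \<iota>_def by (rule bounded_linear_diagonal)
  have open_dom: "open (\<iota> -` D)"
    using assms(1) lin by (auto intro: open_vimage linear_continuous_on)
  have Ck: "Ck_on 2 D f"
    using assms(2) by (simp add: smooth_on_def)
  have f_diff: "f differentiable at (\<iota> z)" if "z \<in> \<iota> -` D" for z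
    using Ck that by (auto simp: numeral_2_eq_2)
  have column_diff: "(\<lambda>z. Amat f i (fst z) (snd z) *v h) differentiable at (x, \<alpha>)" for h
  proof -
    have "(\<lambda>p. frechet_derivative f (at p) (axis i h, 0)) differentiable at (\<iota> (x, \<alpha>))"
      using Ck assms(3) by (auto simp: numeral_2_eq_2 \<iota>_def)
    then have "(\<lambda>z. frechet_derivative f (at (\<iota> z)) (axis i h, 0)) differentiable at (x, \<alpha>)"
      using differentiable_compose[of _ \<iota>] lin bounded_linear_imp_differentiable by blast
    then obtain d where "((\<lambda>z. frechet_derivative f (at (\<iota> z)) (axis i h, 0)) has_derivative d) (at (x, \<alpha>))"
      by (auto simp: differentiable_def)
    then have "((\<lambda>z. Amat f i (fst z) (snd z) *v h) has_derivative d) (at (x, \<alpha>))"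
      by (rule has_derivative_transform_within_open[OF _ open_dom])
         (use assms(3) f_diff in \<open>auto simp: \<iota>_def Amat_mult_vector\<close>)
    then show ?thesis
      by (rule differentiableI)
  qed
  have "(\<lambda>z. Amat f i (fst z) (snd z) \<bullet> axis \<rho> (axis \<nu> 1)) differentiable at (x, \<alpha>)" for \<rho> \<nu>
  proof -
    have "(\<lambda>z. (Amat f i (fst z) (snd z) *v axis \<nu> 1) \<bullet> axis \<rho> 1) differentiable at (x, \<alpha>)"
      by (intro differentiable_inner column_diff differentiable_const)
    then show ?thesis
      by (simp add: inner_axis matrix_vector_mult_basis column_def)
  qed
  then show ?thesis
    by (subst differentiable_componentwise_within) (auto simp: Basis_vec_def)
qed

text \<open>The increment is written as \<open>(\<xi>, \<eta>, w, u, v)\<close> in \<open>(x, \<alpha>, \<omega>, a, b)\<close>. Row vectors multiply the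
  blocks from the left because these are transposed Jacobians. The terms with a gradient of \<open>\<tau>\<close> in
  \<open>B12\<close>, \<open>B13\<close>, \<open>B52\<close>, \<open>B53\<close> come from the dependence of \<open>dcos\<close> and \<open>dsin\<close> on the state-dependent
  delays, for which the derivatives in the delay are \<open>- \<sigma> c - \<omega> s\<close> and \<open>\<omega> c - \<sigma> s\<close>.\<close>

lemma hopf_system_has_derivative:
  fixes f :: "(real^'n^'d) \<times> (real^'p) \<Rightarrow> real^'n"
    and \<tau> :: "'d \<Rightarrow> (real^'n) \<times> (real^'p) \<Rightarrow> real"
  assumes f: "f differentiable at (vec x, \<alpha>)"
    and A: "\<And>i. (\<lambda>z. Amat f i (fst z) (snd z)) differentiable at (x, \<alpha>)"
    and \<tau>: "\<And>i. \<tau> i differentiable at (x, \<alpha>)"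
  shows "(hopf_system \<sigma> f \<tau> has_derivative (\<lambda>(\<xi>, \<eta>, w, u, v).
     (\<xi> v* B11 f x \<alpha> + \<eta> v* B51 f x \<alpha>,
      \<xi> v* B12 \<sigma> f \<tau> x \<alpha> \<omega> a b + \<eta> v* B52 \<sigma> f \<tau> x \<alpha> \<omega> a b + w *\<^sub>R B42 \<sigma> f \<tau> x \<alpha> \<omega> a b
        + u v* B22 \<sigma> f \<tau> x \<alpha> \<omega> + v v* B32 \<sigma> f \<tau> x \<alpha> \<omega>,
      \<xi> v* B13 \<sigma> f \<tau> x \<alpha> \<omega> a b + \<eta> v* B53 \<sigma> f \<tau> x \<alpha> \<omega> a b + w *\<^sub>R B43 \<sigma> f \<tau> x \<alpha> \<omega> a b
        + u v* B23 \<sigma> f \<tau> x \<alpha> \<omega> + v v* B33 \<sigma> f \<tau> x \<alpha> \<omega>,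
      2 * (a \<bullet> u) + 2 * (b \<bullet> v),
      b \<bullet> u + a \<bullet> v))) (at (x, \<alpha>, \<omega>, a, b))"
proof -
  let ?p = "(x, \<alpha>, \<omega>, a, b)"
  define \<phi> where "\<phi> = (\<lambda>z. f (vec (fst z), snd z))"
  define \<A> where "\<A> = (\<lambda>i z. Amat f i (fst z) (snd z))"
  define d\<phi> where "d\<phi> = frechet_derivative \<phi> (at (x, \<alpha>))"
  define dA where "dA = (\<lambda>i. frechet_derivative (\<A> i) (at (x, \<alpha>)))"
  define d\<tau> where "d\<tau> = (\<lambda>i. frechet_derivative (\<tau> i) (at (x, \<alpha>)))"
  let ?st = "\<lambda>q::('n, 'p) hopf_var. (fst q, fst (snd q))"
  let ?om = "\<lambda>q::('n, 'p) hopf_var. fst (snd (snd q))"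
  let ?re = "\<lambda>q::('n, 'p) hopf_var. fst (snd (snd (snd q)))"
  let ?im = "\<lambda>q::('n, 'p) hopf_var. snd (snd (snd (snd q)))"
  have proj: "(?st has_derivative ?st) (at ?p)" "(?om has_derivative ?om) (at ?p)"
    "(?re has_derivative ?re) (at ?p)" "(?im has_derivative ?im) (at ?p)"
    by (auto intro!: derivative_eq_intros)
  have \<phi>: "\<phi> differentiable at (x, \<alpha>)"
    unfolding \<phi>_def
    using f differentiable_compose[of f "\<lambda>z. (vec (fst z), snd z)" "(x, \<alpha>)"]
      bounded_linear_imp_differentiable[OF bounded_linear_diagonal] by force
  have d: "((\<lambda>q. \<phi> (?st q)) has_derivative (\<lambda>q. d\<phi> (?st q))) (at ?p)"
     "((\<lambda>q. \<A> i (?st q)) has_derivative (\<lambda>q. dA i (?st q))) (at ?p)"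
     "((\<lambda>q. \<tau> i (?st q)) has_derivative (\<lambda>q. d\<tau> i (?st q))) (at ?p)" for i
    unfolding d\<phi>_def dA_def d\<tau>_def \<A>_def
    by (rule has_derivative_compose[OF proj(1)], simp add: \<phi> A \<tau> flip: frechet_derivative_works)+
  have d\<phi>_eq: "d\<phi> (\<xi>, \<eta>) = \<xi> v* B11 f x \<alpha> + \<eta> v* B51 f x \<alpha>" for \<xi> \<eta>
    using frechet_derivative_gradient_rows[OF \<phi>] by (simp add: d\<phi>_def \<phi>_def B11_def B51_def)
  have dA_eq: "dA i (\<xi>, \<eta>) *v h = \<xi> v* grad_row (\<lambda>y. Amat f i y \<alpha> *v h) x
      + \<eta> v* grad_row (\<lambda>\<beta>. Amat f i x \<beta> *v h) \<alpha>" for i \<xi> \<eta> h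
    using frechet_derivative_matrix_apply[OF A] by (simp add: dA_def \<A>_def)
  have d\<tau>_eq: "d\<tau> i (\<xi>, \<eta>) = grad (\<lambda>y. \<tau> i (y, \<alpha>)) x \<bullet> \<xi> + grad (\<lambda>\<beta>. \<tau> i (x, \<beta>)) \<alpha> \<bullet> \<eta>" for i \<xi> \<eta>
    using frechet_derivative_gradients[OF \<tau>] by (simp add: d\<tau>_def)
  note mv = bounded_bilinear.FDERIV[OF bounded_bilinear_matrix_vector_mult]
  interpret mv: bounded_bilinear "(*v) :: real^'n^'n \<Rightarrow> real^'n \<Rightarrow> real^'n"
    by (rule bounded_bilinear_matrix_vector_mult)
  interpret vm: bounded_bilinear "(v*) :: real^'n \<Rightarrow> real^'n^'n \<Rightarrow> real^'n"
    by (rule bounded_bilinear_vector_matrix_mult)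
  interpret vmp: bounded_bilinear "(v*) :: real^'p \<Rightarrow> real^'n^'p \<Rightarrow> real^'n"
    by (rule bounded_bilinear_vector_matrix_mult)
  let ?c = "\<lambda>i. dcos \<sigma> \<omega> (\<tau> i (x, \<alpha>))" and ?s = "\<lambda>i. dsin \<sigma> \<omega> (\<tau> i (x, \<alpha>))"
  have sys: "hopf_system \<sigma> f \<tau> = (\<lambda>q. (\<phi> (?st q),
     \<sigma> *\<^sub>R ?re q - ?om q *\<^sub>R ?im q - (\<Sum>i\<in>UNIV. \<A> i (?st q) *v
       (dcos \<sigma> (?om q) (\<tau> i (?st q)) *\<^sub>R ?re q + dsin \<sigma> (?om q) (\<tau> i (?st q)) *\<^sub>R ?im q)),
     ?om q *\<^sub>R ?re q + \<sigma> *\<^sub>R ?im q - (\<Sum>i\<in>UNIV. \<A> i (?st q) *v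
       (dcos \<sigma> (?om q) (\<tau> i (?st q)) *\<^sub>R ?im q - dsin \<sigma> (?om q) (\<tau> i (?st q)) *\<^sub>R ?re q)),
     ?re q \<bullet> ?re q + ?im q \<bullet> ?im q - 1,
     ?re q \<bullet> ?im q))"
    by (auto simp: hopf_system_def Let_def \<phi>_def \<A>_def fun_eq_iff)
  have dc: "((\<lambda>q. dcos \<sigma> (?om q) (\<tau> i (?st q))) has_derivative
      (\<lambda>q. - (\<sigma> * ?c i + \<omega> * ?s i) * d\<tau> i (?st q) - \<tau> i (x, \<alpha>) * ?s i * ?om q)) (at ?p)" for i
    using has_derivative_dcos[OF proj(2) d(3)] by simp
  have ds: "((\<lambda>q. dsin \<sigma> (?om q) (\<tau> i (?st q))) has_derivative
      (\<lambda>q. (\<omega> * ?c i - \<sigma> * ?s i) * d\<tau> i (?st q) + \<tau> i (x, \<alpha>) * ?c i * ?om q)) (at ?p)" for i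
    using has_derivative_dsin[OF proj(2) d(3)] by simp
  \<comment> \<open>Both the derivative delivered by the product rule and the block form are linear combinations of
    the same vectors, summed over the delays; distributing everything brings them to a common
    normal form.\<close>
  note expand = B12_def B52_def B42_def B22_def B32_def B13_def B53_def B43_def B23_def B33_def
      rowP_def rowQ_def dA_eq d\<tau>_eq \<A>_def vector_matrix_mult_outer
      vm.add_right vm.diff_right vm.scaleR_right vm.sum_right vm.minus_right
      vmp.add_right vmp.diff_right vmp.scaleR_right vmp.sum_right
      mv.add_right mv.diff_right mv.scaleR_right mv.minus_right
      algebra_simps sum.distrib sum_subtractf sum_negf scaleR_sum_right
  have "((\<lambda>q. \<sigma> *\<^sub>R ?re q - ?om q *\<^sub>R ?im q - (\<Sum>i\<in>UNIV. \<A> i (?st q) *v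
       (dcos \<sigma> (?om q) (\<tau> i (?st q)) *\<^sub>R ?re q + dsin \<sigma> (?om q) (\<tau> i (?st q)) *\<^sub>R ?im q)))
    has_derivative (\<lambda>(\<xi>, \<eta>, w, u, v).
      \<xi> v* B12 \<sigma> f \<tau> x \<alpha> \<omega> a b + \<eta> v* B52 \<sigma> f \<tau> x \<alpha> \<omega> a b + w *\<^sub>R B42 \<sigma> f \<tau> x \<alpha> \<omega> a b
        + u v* B22 \<sigma> f \<tau> x \<alpha> \<omega> + v v* B32 \<sigma> f \<tau> x \<alpha> \<omega>)) (at ?p)"
    by (rule derivative_eq_intros mv proj d dc ds refl)+
       (auto simp: fun_eq_iff expand)
  moreover have "((\<lambda>q. ?om q *\<^sub>R ?re q + \<sigma> *\<^sub>R ?im q - (\<Sum>i\<in>UNIV. \<A> i (?st q) *v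
       (dcos \<sigma> (?om q) (\<tau> i (?st q)) *\<^sub>R ?im q - dsin \<sigma> (?om q) (\<tau> i (?st q)) *\<^sub>R ?re q)))
    has_derivative (\<lambda>(\<xi>, \<eta>, w, u, v).
      \<xi> v* B13 \<sigma> f \<tau> x \<alpha> \<omega> a b + \<eta> v* B53 \<sigma> f \<tau> x \<alpha> \<omega> a b + w *\<^sub>R B43 \<sigma> f \<tau> x \<alpha> \<omega> a b
        + u v* B23 \<sigma> f \<tau> x \<alpha> \<omega> + v v* B33 \<sigma> f \<tau> x \<alpha> \<omega>)) (at ?p)"
    by (rule derivative_eq_intros mv proj d dc ds refl)+
       (auto simp: fun_eq_iff expand)
  moreover have "((\<lambda>q. ?re q \<bullet> ?re q + ?im q \<bullet> ?im q - 1) has_derivative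
      (\<lambda>(\<xi>, \<eta>, w, u, v). 2 * (a \<bullet> u) + 2 * (b \<bullet> v))) (at ?p)"
    by (rule derivative_eq_intros proj refl)+ (auto simp: fun_eq_iff inner_commute)
  moreover have "((\<lambda>q. ?re q \<bullet> ?im q) has_derivative
      (\<lambda>(\<xi>, \<eta>, w, u, v). b \<bullet> u + a \<bullet> v)) (at ?p)"
    by (rule derivative_eq_intros proj refl)+ (auto simp: fun_eq_iff inner_commute)
  ultimately show ?thesis
    unfolding sys
    by (intro has_derivative_eq_rhs[OF has_derivative_Pair[OF d(1) has_derivative_Pair[OF _
        has_derivative_Pair[OF _ has_derivative_Pair]]]])
       (assumption | simp add: fun_eq_iff d\<phi>_eq)+
qed

section \<open>Normal vectors\<close>

text \<open>The third premise states \<open>n = F'\<^sup>T k\<close> without mentioning the adjoint.\<close>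

lemma normal_space_of_zero_set:
  assumes "(F has_derivative F') (at p)" and "\<And>q. q \<in> M \<Longrightarrow> F q = 0"
    and "\<And>v. n \<bullet> v = k \<bullet> F' v"
  shows "n \<in> normal_space M p"
proof -
  have "n \<bullet> v = 0" if v: "v \<in> tangent_vectors M p" for v
  proof -
    obtain \<gamma> \<epsilon> where \<gamma>: "\<epsilon> > 0" "\<And>t. \<bar>t\<bar> < \<epsilon> \<Longrightarrow> \<gamma> t \<in> M" "\<gamma> 0 = p"
        "(\<gamma> has_vector_derivative v) (at (0::real))"
      using v by (auto simp: tangent_vectors_def)
    have "((\<lambda>t. F (\<gamma> t)) has_derivative (\<lambda>t. F' (t *\<^sub>R v))) (at 0)"
      using has_derivative_compose[of \<gamma> "\<lambda>t. t *\<^sub>R v" 0 UNIV F F'] \<gamma>(3,4) assms(1)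
      by (simp add: has_vector_derivative_def)
    moreover have "((\<lambda>t. F (\<gamma> t)) has_derivative (\<lambda>t. 0)) (at 0)"
      by (rule has_derivative_transform_within_open[of "\<lambda>t. 0" "\<lambda>t. 0" 0 UNIV "{-\<epsilon><..<\<epsilon>}"])
         (use \<gamma> assms(2) in auto)
    ultimately have "(\<lambda>t. F' (t *\<^sub>R v)) = (\<lambda>t. 0)"
      by (rule has_derivative_unique)
    then have "F' (1 *\<^sub>R v) = 0"
      by (rule fun_cong)
    then show ?thesis
      by (simp add: assms(3))
  qed
  then show ?thesis
    by (auto simp: normal_space_def orthogonal_comp_def orthogonal_def inner_commute)
qed

theorem proposition1:
  fixes f :: "(real^'n^'d) \<times> (real^'p) \<Rightarrow> real^'n"
    and \<tau> :: "'d \<Rightarrow> (real^'n) \<times> (real^'p) \<Rightarrow> real"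
    and d0 :: 'd
    and D :: "((real^'n^'d) \<times> (real^'p)) set"
    and E :: "((real^'n) \<times> (real^'p)) set"
    and \<sigma> \<omega> :: real
    and x a b :: "real^'n"
    and \<alpha> r :: "real^'p"
    and U M :: "((real^'n) \<times> (real^'p) \<times> real \<times> (real^'n) \<times> (real^'n)) set"
  assumes "open D" and "smooth_on D f"
    and "open E" and "\<And>i. smooth_on E (\<tau> i)"
    and "\<And>z. z \<in> E \<Longrightarrow> \<tau> d0 z = 0"
    and "(x, \<alpha>, \<omega>, a, b) \<in> hopf_solutions D E \<sigma> f \<tau>"
    and "jacobian_full_rank (hopf_system \<sigma> f \<tau>) (x, \<alpha>, \<omega>, a, b)"
    and "\<exists>(\<kappa>1::real^'n) (\<kappa>2::real^'n) (\<kappa>3::real^'n) (\<kappa>4::real) (\<kappa>5::real).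
           B11 f x \<alpha> *v \<kappa>1 + B12 \<sigma> f \<tau> x \<alpha> \<omega> a b *v \<kappa>2 + B13 \<sigma> f \<tau> x \<alpha> \<omega> a b *v \<kappa>3 = 0 \<and>
           B22 \<sigma> f \<tau> x \<alpha> \<omega> *v \<kappa>2 + B23 \<sigma> f \<tau> x \<alpha> \<omega> *v \<kappa>3 + \<kappa>4 *\<^sub>R (2 *\<^sub>R a) + \<kappa>5 *\<^sub>R b = 0 \<and>
           B32 \<sigma> f \<tau> x \<alpha> \<omega> *v \<kappa>2 + B33 \<sigma> f \<tau> x \<alpha> \<omega> *v \<kappa>3 + \<kappa>4 *\<^sub>R (2 *\<^sub>R b) + \<kappa>5 *\<^sub>R a = 0 \<and>
           B42 \<sigma> f \<tau> x \<alpha> \<omega> a b \<bullet> \<kappa>2 + B43 \<sigma> f \<tau> x \<alpha> \<omega> a b \<bullet> \<kappa>3 = 0 \<and>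
           B51 f x \<alpha> *v \<kappa>1 + B52 \<sigma> f \<tau> x \<alpha> \<omega> a b *v \<kappa>2 + B53 \<sigma> f \<tau> x \<alpha> \<omega> a b *v \<kappa>3 - r = 0"
    and "r \<bullet> r - 1 = 0"
    and "open U" and "(x, \<alpha>, \<omega>, a, b) \<in> U" and "M = U \<inter> hopf_solutions D E \<sigma> f \<tau>"
  shows "normal_in_parameter_space r M (x, \<alpha>, \<omega>, a, b)"
proof -
  obtain \<kappa>1 \<kappa>2 \<kappa>3 :: "real^'n" and \<kappa>4 \<kappa>5 :: real where \<kappa>:
    "B11 f x \<alpha> *v \<kappa>1 + B12 \<sigma> f \<tau> x \<alpha> \<omega> a b *v \<kappa>2 + B13 \<sigma> f \<tau> x \<alpha> \<omega> a b *v \<kappa>3 = 0"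
    "B22 \<sigma> f \<tau> x \<alpha> \<omega> *v \<kappa>2 + B23 \<sigma> f \<tau> x \<alpha> \<omega> *v \<kappa>3 + \<kappa>4 *\<^sub>R (2 *\<^sub>R a) + \<kappa>5 *\<^sub>R b = 0"
    "B32 \<sigma> f \<tau> x \<alpha> \<omega> *v \<kappa>2 + B33 \<sigma> f \<tau> x \<alpha> \<omega> *v \<kappa>3 + \<kappa>4 *\<^sub>R (2 *\<^sub>R b) + \<kappa>5 *\<^sub>R a = 0"
    "B42 \<sigma> f \<tau> x \<alpha> \<omega> a b \<bullet> \<kappa>2 + B43 \<sigma> f \<tau> x \<alpha> \<omega> a b \<bullet> \<kappa>3 = 0"
    "r = B51 f x \<alpha> *v \<kappa>1 + B52 \<sigma> f \<tau> x \<alpha> \<omega> a b *v \<kappa>2 + B53 \<sigma> f \<tau> x \<alpha> \<omega> a b *v \<kappa>3"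
    using assms(8) by auto
  have dom: "(vec x, \<alpha>) \<in> D" "(x, \<alpha>) \<in> E"
    using assms(6) by (auto simp: hopf_solutions_def)
  have Ck: "Ck_on 1 D f" "\<And>i. Ck_on 1 E (\<tau> i)"
    using assms(2,4) by (auto simp: smooth_on_def)
  have f: "f differentiable at (vec x, \<alpha>)" and \<tau>: "\<tau> i differentiable at (x, \<alpha>)" for i
    using Ck dom by auto
  have A: "(\<lambda>z. Amat f i (fst z) (snd z)) differentiable at (x, \<alpha>)" for i
    using assms(1,2) dom(1) by (rule differentiable_Amat)
  show ?thesis
    unfolding normal_in_parameter_space_def
  proof (rule normal_space_of_zero_set[where k = "(\<kappa>1, \<kappa>2, \<kappa>3, \<kappa>4, \<kappa>5)"])
    show "hopf_system \<sigma> f \<tau> q = 0" if "q \<in> M" for q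
      using that assms(12) by (auto simp: hopf_solutions_def)
  next
    fix V :: "('n, 'p) hopf_var"
    obtain \<xi> \<eta> w u v where V: "V = (\<xi>, \<eta>, w, u, v)"
      by (cases V) auto
    \<comment> \<open>The \<open>x\<close>-, \<open>a\<close>-, \<open>b\<close>- and \<open>\<omega>\<close>-components of \<open>F'\<^sup>T \<kappa>\<close> vanish, so they contribute nothing
      to the inner product with \<open>V\<close>.\<close>
    have "\<xi> \<bullet> (B11 f x \<alpha> *v \<kappa>1 + B12 \<sigma> f \<tau> x \<alpha> \<omega> a b *v \<kappa>2 + B13 \<sigma> f \<tau> x \<alpha> \<omega> a b *v \<kappa>3)
      + u \<bullet> (B22 \<sigma> f \<tau> x \<alpha> \<omega> *v \<kappa>2 + B23 \<sigma> f \<tau> x \<alpha> \<omega> *v \<kappa>3 + \<kappa>4 *\<^sub>R (2 *\<^sub>R a) + \<kappa>5 *\<^sub>R b)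
      + v \<bullet> (B32 \<sigma> f \<tau> x \<alpha> \<omega> *v \<kappa>2 + B33 \<sigma> f \<tau> x \<alpha> \<omega> *v \<kappa>3 + \<kappa>4 *\<^sub>R (2 *\<^sub>R b) + \<kappa>5 *\<^sub>R a)
      + w * (B42 \<sigma> f \<tau> x \<alpha> \<omega> a b \<bullet> \<kappa>2 + B43 \<sigma> f \<tau> x \<alpha> \<omega> a b \<bullet> \<kappa>3) = 0"
      unfolding \<kappa>(1-4) by simp
    then show "(0, r, 0, 0, 0) \<bullet> V = (\<kappa>1, \<kappa>2, \<kappa>3, \<kappa>4, \<kappa>5) \<bullet> (case V of (\<xi>, \<eta>, w, u, v) \<Rightarrow>
     (\<xi> v* B11 f x \<alpha> + \<eta> v* B51 f x \<alpha>,
      \<xi> v* B12 \<sigma> f \<tau> x \<alpha> \<omega> a b + \<eta> v* B52 \<sigma> f \<tau> x \<alpha> \<omega> a b + w *\<^sub>R B42 \<sigma> f \<tau> x \<alpha> \<omega> a b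
        + u v* B22 \<sigma> f \<tau> x \<alpha> \<omega> + v v* B32 \<sigma> f \<tau> x \<alpha> \<omega>,
      \<xi> v* B13 \<sigma> f \<tau> x \<alpha> \<omega> a b + \<eta> v* B53 \<sigma> f \<tau> x \<alpha> \<omega> a b + w *\<^sub>R B43 \<sigma> f \<tau> x \<alpha> \<omega> a b
        + u v* B23 \<sigma> f \<tau> x \<alpha> \<omega> + v v* B33 \<sigma> f \<tau> x \<alpha> \<omega>,
      2 * (a \<bullet> u) + 2 * (b \<bullet> v),
      b \<bullet> u + a \<bullet> v))"
      by (simp add: V \<kappa>(5) inner_commute[of _ \<eta>] inner_commute[of \<kappa>1] inner_commute[of \<kappa>2]
          inner_commute[of \<kappa>3] inner_commute[of _ a] inner_commute[of _ b] dot_lmul_matrix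
          inner_add_left inner_add_right algebra_simps)
  qed (intro hopf_system_has_derivative f A \<tau>)
qed

end
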